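(* Let $(\mathfrak{g},\langle\cdot,\cdot\rangle)$ be a flat Lie algebra of odd dimension. Then $\mathfrak{g}$ admits a coKähler structure.
   Context: All Lie algebras are real and finite-dimensional. Flat: a metric Lie algebra $(\mathfrak{g},\langle\cdot,\cdot\rangle)$ is a Lie algebra with an inner product. Its Levi-Civita connection $\nabla$ is given by the Koszul formula $2\langle\nabla_XY,Z\rangle=\langle[X,Y],Z\rangle-\langle[Y,Z],X\rangle+\langle[Z,X],Y\rangle$, and its curvature is $R(X,Y)Z=\nabla_X\nabla_YZ-\nabla_Y\nabla_XZ-\nabla_{[X,Y]}Z$. It is flat if $R\equiv 0$. CoKähler structure: a coKähler structure on a Lie algebra $\mathfrak{g}$ of dimension $2n+1$ is a quadruple $(J,\xi,\alpha,\langle\cdot,\cdot\rangle)$, where $\xi\in\mathfrak{g}$ is a non-zero vector, $\alpha\in\mathfrak{g}^*$, $J$ is an endomorphism of $\mathfrak{g}$ and $\langle\cdot,\cdot\rangle$ is an inner product on $\mathfrak{g}$, such that $\alpha(\xi)=1$, $J^2=-\mathrm{Id}+\alpha\otimes\xi$, $\langle JX,JY\rangle=\langle X,Y\rangle-\alpha(X)\alpha(Y)$, $d\alpha=0$, $N_J=0$ and $d\omega=0$. Here $\omega(X,Y)=\langle JX,Y\rangle$ is the fundamental form, $d$ is the Chevalley–Eilenberg differential (so $d\alpha=0$ means $\alpha([X,Y])=0$, and $d\omega=0$ means $\omega([X,Y],Z)+\omega([Y,Z],X)+\omega([Z,X],Y)=0$), and $N_J(X,Y)=[JX,JY]-J[JX,Y]-J[X,JY]+J^2[X,Y]$.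 The inner product of the coKähler structure is part of the structure. *)

theory Defs
  imports "HOL-Analysis.Analysis"
begin

text \<open>The class \<open>euclidean_space\<close> serves only to provide a finite-dimensional real vector space.
  Brackets and inner products are explicit functions on it; the canonical inner product of the
  type is never used.\<close>

definition lie_bracket :: "('a::euclidean_space \<Rightarrow> 'a \<Rightarrow> 'a) \<Rightarrow> bool" where
  "lie_bracket br \<longleftrightarrow>
     bilinear br \<and>
     (\<forall>X. br X X = 0) \<and>
     (\<forall>X Y Z. br X (br Y Z) + br Y (br Z X) + br Z (br X Y) = 0)"

definition inner_product :: "('a::euclidean_space \<Rightarrow> 'a \<Rightarrow> real) \<Rightarrow> bool" where
  "inner_product ip \<longleftrightarrow>
     bilinear ip \<and>
     (\<forall>X Y. ip X Y = ip Y X) \<and>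
     (\<forall>X. X \<noteq> 0 \<longrightarrow> ip X X > 0)"

definition metric_lie_algebra ::
    "('a::euclidean_space \<Rightarrow> 'a \<Rightarrow> 'a) \<Rightarrow> ('a \<Rightarrow> 'a \<Rightarrow> real) \<Rightarrow> bool" where
  "metric_lie_algebra br ip \<longleftrightarrow> lie_bracket br \<and> inner_product ip"

definition levi_civita ::
    "('a::euclidean_space \<Rightarrow> 'a \<Rightarrow> 'a) \<Rightarrow> ('a \<Rightarrow> 'a \<Rightarrow> real) \<Rightarrow> 'a \<Rightarrow> 'a \<Rightarrow> 'a" where
  "levi_civita br ip X Y =
     (THE W. \<forall>Z. 2 * ip W Z = ip (br X Y) Z - ip (br Y Z) X + ip (br Z X) Y)"

text \<open>The description in \<open>levi_civita\<close> is proper: the Koszul formula has exactly one solution.\<close>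

lemma levi_civita_koszul:
  fixes br :: "'a::euclidean_space \<Rightarrow> 'a \<Rightarrow> 'a"
  assumes "metric_lie_algebra br ip"
  shows "2 * ip (levi_civita br ip X Y) Z = ip (br X Y) Z - ip (br Y Z) X + ip (br Z X) Y"
proof -
  have br: "bilinear br" and ip: "bilinear ip" and pos: "\<And>X. X \<noteq> 0 \<Longrightarrow> ip X X > 0"
    using assms by (auto simp: metric_lie_algebra_def lie_bracket_def inner_product_def)
  define k where "k Z = (ip (br X Y) Z - ip (br Y Z) X + ip (br Z X) Y) / 2" for Z
  have lk: "linear k"
    unfolding k_def
    by (rule linearI)
      (simp_all add: bilinear_ladd[OF ip] bilinear_radd[OF ip] bilinear_ladd[OF br]
        bilinear_radd[OF br] bilinear_lmul[OF ip] bilinear_rmul[OF ip] bilinear_lmul[OF br]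
        bilinear_rmul[OF br] field_simps)
  define L where "L W = (\<Sum>b\<in>Basis. ip W b *\<^sub>R b)" for W
  have lL: "linear L"
    unfolding L_def
    by (rule linearI)
      (simp_all add: bilinear_ladd[OF ip] bilinear_lmul[OF ip] scaleR_left_distrib
        sum.distrib scaleR_sum_right)
  have lip: "linear (ip W)" for W
    using ip by (simp add: bilinear_def)
  have inj: "W = 0" if "\<And>Z. ip W Z = 0" for W
    using pos[of W] that[of W] by auto
  have "W = 0" if "L W = 0" for W
  proof (rule inj)
    have "ip W b = 0" if "b \<in> Basis" for b
      using arg_cong[OF \<open>L W = 0\<close>, of "\<lambda>v. v \<bullet> b"] that
      by (simp add: L_def inner_sum_left inner_Basis if_distrib cong: if_cong)
    then show "ip W Z = 0" for Z
      using linear_eq_stdbasis[OF lip[of W] linear_zero] by metis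
  qed
  then have "inj L"
    using lL by (simp add: linear_injective_0)
  then have "surj L"
    using lL linear_injective_imp_surjective by blast
  then obtain W where W: "L W = (\<Sum>b\<in>Basis. k b *\<^sub>R b)"
    by (metis surjD)
  have "ip W b = k b" if "b \<in> Basis" for b
    using arg_cong[OF W, of "\<lambda>v. v \<bullet> b"] that
    by (simp add: L_def inner_sum_left inner_Basis if_distrib cong: if_cong)
  then have "ip W = k"
    using linear_eq_stdbasis[OF lip[of W] lk] by blast
  then have W': "\<forall>Z. 2 * ip W Z = ip (br X Y) Z - ip (br Y Z) X + ip (br Z X) Y"
    by (simp add: k_def)
  have "V = W"
    if V: "\<forall>Z. 2 * ip V Z = ip (br X Y) Z - ip (br Y Z) X + ip (br Z X) Y" for V
  proof -
    have "ip (V - W) Z = 0" for Z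
      using V[rule_format, of Z] W'[rule_format, of Z] by (simp add: bilinear_lsub[OF ip])
    then show ?thesis
      using inj[of "V - W"] by simp
  qed
  with W' have "\<exists>!W. \<forall>Z. 2 * ip W Z = ip (br X Y) Z - ip (br Y Z) X + ip (br Z X) Y"
    by blast
  from theI'[OF this] show ?thesis
    unfolding levi_civita_def by blast
qed

definition curvature ::
    "('a::euclidean_space \<Rightarrow> 'a \<Rightarrow> 'a) \<Rightarrow> ('a \<Rightarrow> 'a \<Rightarrow> real) \<Rightarrow> 'a \<Rightarrow> 'a \<Rightarrow> 'a \<Rightarrow> 'a" where
  "curvature br ip X Y Z =
     levi_civita br ip X (levi_civita br ip Y Z)
     - levi_civita br ip Y (levi_civita br ip X Z)
     - levi_civita br ip (br X Y) Z"

definition flat_lie_algebra ::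
    "('a::euclidean_space \<Rightarrow> 'a \<Rightarrow> 'a) \<Rightarrow> ('a \<Rightarrow> 'a \<Rightarrow> real) \<Rightarrow> bool" where
  "flat_lie_algebra br ip \<longleftrightarrow>
     metric_lie_algebra br ip \<and> (\<forall>X Y Z. curvature br ip X Y Z = 0)"

text \<open>The Chevalley--Eilenberg differential (trivial coefficients) on 1-forms and 2-forms.\<close>

definition ce_d1 ::
    "('a::euclidean_space \<Rightarrow> 'a \<Rightarrow> 'a) \<Rightarrow> ('a \<Rightarrow> real) \<Rightarrow> 'a \<Rightarrow> 'a \<Rightarrow> real" where
  "ce_d1 br \<alpha> X Y = - \<alpha> (br X Y)"

definition ce_d2 ::
    "('a::euclidean_space \<Rightarrow> 'a \<Rightarrow> 'a) \<Rightarrow> ('a \<Rightarrow> 'a \<Rightarrow> real) \<Rightarrow> 'a \<Rightarrow> 'a \<Rightarrow> 'a \<Rightarrow> real" where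
  "ce_d2 br \<omega> X Y Z = - (\<omega> (br X Y) Z + \<omega> (br Y Z) X + \<omega> (br Z X) Y)"

definition nijenhuis ::
    "('a::euclidean_space \<Rightarrow> 'a \<Rightarrow> 'a) \<Rightarrow> ('a \<Rightarrow> 'a) \<Rightarrow> 'a \<Rightarrow> 'a \<Rightarrow> 'a" where
  "nijenhuis br J X Y = br (J X) (J Y) - J (br (J X) Y) - J (br X (J Y)) + J (J (br X Y))"

definition fundamental_form ::
    "('a::euclidean_space \<Rightarrow> 'a) \<Rightarrow> ('a \<Rightarrow> 'a \<Rightarrow> real) \<Rightarrow> 'a \<Rightarrow> 'a \<Rightarrow> real" where
  "fundamental_form J ip X Y = ip (J X) Y"

definition cokaehler_structure ::
    "('a::euclidean_space \<Rightarrow> 'a \<Rightarrow> 'a) \<Rightarrow> ('a \<Rightarrow> 'a) \<Rightarrow> 'a \<Rightarrow> ('a \<Rightarrow> real) \<Rightarrow> ('a \<Rightarrow> 'a \<Rightarrow> real) \<Rightarrow> bool"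
  where
  "cokaehler_structure br J \<xi> \<alpha> ip \<longleftrightarrow>
     lie_bracket br \<and> (\<exists>n. DIM('a) = 2 * n + 1) \<and>
     linear J \<and> \<xi> \<noteq> 0 \<and> linear \<alpha> \<and> inner_product ip \<and>
     \<alpha> \<xi> = 1 \<and>
     (\<forall>X. J (J X) = - X + \<alpha> X *\<^sub>R \<xi>) \<and>
     (\<forall>X Y. ip (J X) (J Y) = ip X Y - \<alpha> X * \<alpha> Y) \<and>
     (\<forall>X Y. ce_d1 br \<alpha> X Y = 0) \<and>
     (\<forall>X Y. nijenhuis br J X Y = 0) \<and>
     (\<forall>X Y Z. ce_d2 br (fundamental_form J ip) X Y Z = 0)"

end

theory Submission
  imports Defs
begin

text \<open>
  Flatness makes \<open>X \<mapsto> \<nabla>\<^sub>X\<close> a representation of the Lie algebra by skew operators. Let \<open>u\<close> be its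
  kernel and \<open>b\<close> the orthogonal complement of \<open>u\<close>. On \<open>b\<close> the trace form \<open>- tr (\<nabla>\<^sub>X \<nabla>\<^sub>Y)\<close> is
  positive definite and invariant. Since the torsion vanishes, the identity map of \<open>b\<close> is a
  cocycle, so for an orthonormal basis \<open>E\<close> of the trace form the vector \<open>v = \<Sum>e\<in>E. \<nabla>\<^sub>e e\<close> satisfies
  \<open>\<nabla>\<^sub>X v = C X\<close>, where \<open>C = \<Sum>e\<in>E. \<nabla>\<^sub>e \<nabla>\<^sub>e\<close> is the Casimir operator. Skewness gives \<open>\<langle>C v, v\<rangle> = 0\<close>,
  hence \<open>\<nabla>\<^sub>X v = 0\<close> on \<open>b\<close>, hence \<open>C = 0\<close> on \<open>b\<close> and \<open>\<nabla>\<^sub>X Y = 0\<close> for \<open>X, Y \<in> b\<close>. So all the operators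
  \<open>\<nabla>\<^sub>X\<close> commute. A commuting family of skew operators on an odd-dimensional space has a unit
  vector \<open>\<xi>\<close> in its common kernel and commutes with an orthogonal complex structure on \<open>\<xi>\<^sup>\<bottom>\<close>,
  which extends by \<open>J \<xi> = 0\<close>. Then \<open>J\<close> and \<open>\<xi>\<close> are parallel and all coKaehler identities follow.
\<close>

section \<open>Orthonormal bases, traces and orthogonal projections\<close>

text \<open>Gram-Schmidt by induction on the dimension: normalise one vector and pass to its
  complement in \<open>S\<close>. Positivity is asked only on \<open>S\<close>, because one of the
  forms treated below is merely semidefinite on the whole space.\<close>

lemma form_orthonormal_basis:
  fixes S :: "'a::euclidean_space set"
  assumes B: "bilinear B" and sym: "\<And>x y. B x y = B y x"
    and "subspace S" and "\<And>x. x \<in> S \<Longrightarrow> x \<noteq> 0 \<Longrightarrow> B x x > (0::real)"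
  shows "\<exists>E\<subseteq>S. finite E \<and> span E = S \<and> (\<forall>x\<in>E. \<forall>y\<in>E. B x y = (if x = y then 1 else 0))"
  using assms(3,4)
proof (induction "dim S" arbitrary: S rule: less_induct)
  case less
  show ?case
  proof (cases "S \<subseteq> {0}")
    case True
    then have "S = {0}" using less.prems(1) subspace_0 by blast
    then show ?thesis by (intro exI[of _ "{}"]) auto
  next
    case False
    then obtain x where x: "x \<in> S" "x \<noteq> 0" by blast
    define e where "e = (1 / sqrt (B x x)) *\<^sub>R x"
    have pos: "B x x > 0" using less.prems(2) x by blast
    have eS: "e \<in> S" using x less.prems(1) by (simp add: e_def subspace_scale)
    have ee: "B e e = 1"
      using pos by (simp add: e_def bilinear_lmul[OF B] bilinear_rmul[OF B])
    define T where "T = {y \<in> S. B y e = 0}"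
    have TS: "T \<subseteq> S" by (auto simp: T_def)
    have T: "subspace T"
      using less.prems(1)
      by (auto simp: T_def subspace_def bilinear_ladd[OF B] bilinear_lmul[OF B] bilinear_lzero[OF B])
    have "e \<notin> T" using ee by (simp add: T_def)
    then have "T \<noteq> S" using eS by blast
    then have "dim T < dim S"
      using T less.prems(1) TS by (metis dim_subset le_neq_implies_less subspace_dim_equal)
    then obtain E where E: "E \<subseteq> T" "finite E" "span E = T"
        "\<forall>x\<in>E. \<forall>y\<in>E. B x y = (if x = y then 1 else 0)"
      using less.hyps[of T] T TS less.prems(2) by blast
    have "span (insert e E) = S"
    proof
      show "span (insert e E) \<subseteq> S"
        using E(1) TS eS less.prems(1) by (intro span_minimal) auto
      show "S \<subseteq> span (insert e E)"
      proof
        fix y assume y: "y \<in> S"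
        have "y - B y e *\<^sub>R e \<in> T"
          using y eS less.prems(1) ee
          by (simp add: T_def subspace_diff subspace_scale bilinear_lsub[OF B] bilinear_lmul[OF B])
        then show "y \<in> span (insert e E)"
          using E(3) by (auto simp: span_breakdown_eq)
      qed
    qed
    moreover have "B z e = 0" "B e z = 0" if "z \<in> E" for z
      using that E(1) sym[of e z] by (auto simp: T_def)
    ultimately show ?thesis
      using E TS eS ee by (intro exI[of _ "insert e E"]) auto
  qed
qed

lemma form_orthonormal_expansion:
  assumes B: "bilinear B" and E: "finite E" and on: "\<forall>x\<in>E. \<forall>y\<in>E. B x y = (if x = y then 1 else (0::real))"
    and x: "x \<in> span E"
  shows "x = (\<Sum>e\<in>E. B x e *\<^sub>R e)"
proof -
  obtain c where c: "x = (\<Sum>e\<in>E. c e *\<^sub>R e)"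
    using x E by (auto simp: span_finite)
  have lin: "linear (\<lambda>x. B x z)" for z using B by (simp add: bilinear_def)
  have "B x e = c e" if "e \<in> E" for e
  proof -
    have "B x e = (\<Sum>d\<in>E. c d * B d e)"
      by (simp add: c linear_sum[OF lin] linear_cmul[OF lin])
    also have "\<dots> = (\<Sum>d\<in>E. if d = e then c d else 0)"
      using on that by (intro sum.cong) auto
    finally show ?thesis using E that by simp
  qed
  then show ?thesis using c by simp
qed

text \<open>Carries an arbitrary inner product to \<open>\<bullet>\<close>, so that norms,
  compactness and orthogonality of the type become available. The map \<open>f\<close> sends the
  standard basis to an \<open>ip\<close>-orthonormal one.\<close>

lemma inner_product_isometry:
  fixes ip :: "'a::euclidean_space \<Rightarrow> 'a \<Rightarrow> real"
  assumes "inner_product ip"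
  shows "\<exists>f g :: 'a \<Rightarrow> 'a. linear f \<and> linear g \<and> (\<forall>x. f (g x) = x) \<and> (\<forall>x. g (f x) = x) \<and>
    (\<forall>x y. ip (f x) (f y) = x \<bullet> y)"
proof -
  have ip: "bilinear ip" and sym: "\<And>x y. ip x y = ip y x" and pos: "\<And>x. x \<noteq> 0 \<Longrightarrow> ip x x > 0"
    using assms by (auto simp: inner_product_def)
  obtain E where E: "finite E" "span E = (UNIV::'a set)"
      "\<forall>x\<in>E. \<forall>y\<in>E. ip x y = (if x = y then 1 else 0)"
    using form_orthonormal_basis[OF ip sym subspace_UNIV] pos by blast
  have expand: "x = (\<Sum>e\<in>E. ip x e *\<^sub>R e)" for x
    using form_orthonormal_expansion[OF ip E(1,3)] E(2) by simp
  have lin: "linear (\<lambda>x. ip x z)" "linear (\<lambda>x. ip z x)" for z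
    using ip by (simp_all add: bilinear_def)
  have "independent E"
  proof (rule independent_if_scalars_zero[OF E(1)])
    fix c e assume 0: "(\<Sum>x\<in>E. c x *\<^sub>R x) = 0" and e: "e \<in> E"
    have "0 = ip (\<Sum>x\<in>E. c x *\<^sub>R x) e" by (simp add: 0 bilinear_lzero[OF ip])
    also have "\<dots> = (\<Sum>d\<in>E. c d * ip d e)"
      by (simp add: linear_sum[OF lin(1)] linear_cmul[OF lin(1)])
    also have "\<dots> = (\<Sum>d\<in>E. if d = e then c d else 0)"
      using E(3) e by (intro sum.cong) auto
    finally show "c e = 0" using E(1) e by simp
  qed
  then have "card E = DIM('a)"
    using E(2) by (metis dim_UNIV dim_eq_card_independent dim_span)
  then obtain h where h: "bij_betw h (Basis::'a set) E"
    using E(1) finite_same_card_bij finite_Basis by metis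
  define f where "f x = (\<Sum>i\<in>Basis. (x \<bullet> i) *\<^sub>R h i)" for x :: 'a
  have f: "linear f"
    by (rule linearI)
      (simp_all add: f_def inner_add_left scaleR_left_distrib sum.distrib scaleR_sum_right)
  have hip: "ip (h i) (h j) = (if i = j then 1 else 0)" if "i \<in> Basis" "j \<in> Basis" for i j
    using that h E(3) by (auto simp: bij_betw_def inj_on_def)
  have iso: "ip (f x) (f y) = x \<bullet> y" for x y
  proof -
    have "ip (f x) (f y) = (\<Sum>i\<in>Basis. (x \<bullet> i) * ip (h i) (f y))"
      unfolding f_def[of x] by (simp add: linear_sum[OF lin(1)] linear_cmul[OF lin(1)])
    moreover have "ip w (f y) = (\<Sum>j\<in>Basis. (y \<bullet> j) * ip w (h j))" for w
      unfolding f_def by (simp add: linear_sum[OF lin(2)] linear_cmul[OF lin(2)])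
    ultimately have "ip (f x) (f y) =
        (\<Sum>i\<in>Basis. (x \<bullet> i) * (\<Sum>j\<in>Basis. (y \<bullet> j) * ip (h i) (h j)))"
      by simp
    also have "\<dots> = (\<Sum>i\<in>Basis. (x \<bullet> i) * (\<Sum>j\<in>Basis. if i = j then y \<bullet> j else 0))"
      by (intro sum.cong arg_cong2[of _ _ _ _ "(*)"] refl) (auto simp: hip)
    also have "\<dots> = x \<bullet> y" by (simp add: euclidean_inner[of x y])
    finally show ?thesis .
  qed
  have "inj f"
    unfolding linear_injective_0[OF f] using iso by (metis bilinear_lzero[OF ip] inner_eq_zero_iff)
  then obtain g where "linear g" "\<forall>x. f (g x) = x" "\<forall>x. g (f x) = x"
    using linear_injective_isomorphism[OF f] by blast
  then show ?thesis using f iso by blast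
qed

text \<open>Both sides are traces of composites and expand to the same double sum of products of
  matrix entries.\<close>

lemma trace_commute:
  fixes f g :: "'a::euclidean_space \<Rightarrow> 'a"
  assumes f: "linear f" and g: "linear g"
  shows "(\<Sum>i\<in>Basis. f (g i) \<bullet> i) = (\<Sum>i\<in>Basis. g (f i) \<bullet> i)"
proof -
  have *: "(\<Sum>i\<in>Basis. f (g i) \<bullet> i) = (\<Sum>i\<in>Basis. \<Sum>j\<in>Basis. (g i \<bullet> j) * (f j \<bullet> i))"
    if "linear f" for f g :: "'a \<Rightarrow> 'a"
  proof (intro sum.cong refl)
    fix i
    have "f (g i) = f (\<Sum>j\<in>Basis. (g i \<bullet> j) *\<^sub>R j)" by (simp add: euclidean_representation)
    also have "\<dots> = (\<Sum>j\<in>Basis. (g i \<bullet> j) *\<^sub>R f j)"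
      by (simp add: linear_sum[OF that] linear_cmul[OF that])
    finally show "f (g i) \<bullet> i = (\<Sum>j\<in>Basis. (g i \<bullet> j) * (f j \<bullet> i))"
      by (simp add: inner_sum_left)
  qed
  show ?thesis
    unfolding *[OF f] *[OF g] by (subst sum.swap) (simp add: mult.commute)
qed

lemma orthogonal_projection_exists:
  fixes T :: "'a::euclidean_space set"
  assumes "subspace T"
  shows "\<exists>P. linear P \<and> (\<forall>x. P x \<in> T) \<and> (\<forall>x. \<forall>y\<in>T. y \<bullet> (x - P x) = 0)"
proof -
  obtain E where E: "finite E" "span E = T" "E \<subseteq> T"
      "\<forall>x\<in>E. \<forall>y\<in>E. x \<bullet> y = (if x = y then 1 else 0)"
    using form_orthonormal_basis[of "(\<bullet>)", OF _ _ assms]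
    by (auto simp: inner_commute bilinear_conv_bounded_bilinear bounded_bilinear_inner)
  define P where "P x = (\<Sum>e\<in>E. (x \<bullet> e) *\<^sub>R e)" for x
  have "linear P"
    by (rule linearI)
      (simp_all add: P_def inner_add_left scaleR_left_distrib sum.distrib scaleR_sum_right)
  moreover have "P x \<in> T" for x
    unfolding P_def using E(3) assms by (intro subspace_sum subspace_scale) auto
  moreover have "y \<bullet> (x - P x) = 0" if "y \<in> T" for x y
  proof -
    have "y = (\<Sum>e\<in>E. (y \<bullet> e) *\<^sub>R e)"
      using form_orthonormal_expansion[of "(\<bullet>)" E y] E that
      by (auto simp: bilinear_conv_bounded_bilinear bounded_bilinear_inner)
    then have "y \<bullet> x = (\<Sum>e\<in>E. (y \<bullet> e) * (e \<bullet> x))"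
      by (metis (no_types, lifting) inner_scaleR_left inner_sum_left sum.cong)
    then show ?thesis
      by (simp add: P_def inner_diff_right inner_sum_right inner_commute mult.commute)
  qed
  ultimately show ?thesis by blast
qed

section \<open>Flat torsion-free metric connections\<close>

text \<open>The hypothesis \<open>flat\<close> merges zero torsion with zero curvature by writing
  the bracket as \<open>D X Y - D Y X\<close>. The operators commute because this bracket vanishes
  on the complement of the kernel of \<open>D\<close>, and \<open>D X\<close> depends only on the
  component of \<open>X\<close> there.\<close>

lemma flat_connection_commutes:
  fixes D :: "'a::euclidean_space \<Rightarrow> 'a \<Rightarrow> 'a"
  assumes D: "bilinear D"
    and skew: "\<And>X Y Z. D X Y \<bullet> Z = - (Y \<bullet> D X Z)"
    and flat: "\<And>X Y Z. D (D X Y - D Y X) Z = D X (D Y Z) - D Y (D X Z)"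
  shows "D X (D Y Z) = D Y (D X Z)"
proof -
  define br where "br X Y = D X Y - D Y X" for X Y
  define u where "u = {X. \<forall>Z. D X Z = 0}"
  define b where "b = {y. \<forall>x\<in>u. x \<bullet> y = 0}"
  have linr: "linear (D X)" and linl: "linear (\<lambda>X. D X Z)" for X Z
    using D by (simp_all add: bilinear_def)
  note lin_simps = bilinear_ladd[OF D] bilinear_radd[OF D] bilinear_lmul[OF D] bilinear_rmul[OF D]
    bilinear_lzero[OF D] bilinear_rzero[OF D] bilinear_lsub[OF D] bilinear_rsub[OF D]
  have u: "subspace u"
    by (auto simp: u_def subspace_def lin_simps)
  have b: "subspace b"
    by (auto simp: b_def subspace_def inner_add_right)
  \<comment> \<open>\<open>u\<close> is an ideal: for \<open>X\<close> in \<open>u\<close> the right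
    side of \<open>flat\<close> vanishes and the bracket of \<open>Y\<close> and \<open>X\<close> is
    just \<open>D Y X\<close>. Skewness then makes \<open>b\<close> stable too.\<close>
  have Du: "D Y X \<in> u" if "X \<in> u" for X Y
    using that flat[of Y X] by (simp add: u_def lin_simps)
  have Db: "D Y X \<in> b" if "X \<in> b" for X Y
    unfolding b_def
  proof (intro CollectI ballI)
    fix x assume "x \<in> u"
    then show "x \<bullet> D Y X = 0"
      using skew[of Y x X] Du[of x Y] that by (simp add: b_def)
  qed
  have brb: "br X Y \<in> b" if "X \<in> b" "Y \<in> b" for X Y
    using that Db b by (simp add: br_def subspace_diff)

  \<comment> \<open>This is \<open>- tr (D X D Y)\<close>, rewritten by skewness as a sum of inner
    products; it is thus visibly semidefinite, with radical \<open>u\<close>.\<close>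
  define B where "B X Y = (\<Sum>i\<in>Basis. D X i \<bullet> D Y i)" for X Y
  have B: "bilinear B"
    unfolding bilinear_def B_def
    by (auto intro!: linearI simp: lin_simps inner_add_left inner_add_right sum.distrib sum_distrib_left)
  have Bsym: "B X Y = B Y X" for X Y
    by (simp add: B_def inner_commute)
  have Bpos: "B X X > 0" if "X \<in> b" "X \<noteq> 0" for X
  proof (rule ccontr)
    assume "\<not> B X X > 0"
    moreover have "B X X \<ge> 0" by (simp add: B_def sum_nonneg)
    ultimately have "(\<Sum>i\<in>Basis. D X i \<bullet> D X i) = 0" by (simp add: B_def)
    then have "\<forall>i\<in>Basis. D X i = 0"
      by (subst (asm) sum_nonneg_eq_0_iff) auto
    then have "X \<in> u"
      using linear_eq_stdbasis[OF linr[of X] linear_zero] by (auto simp: u_def)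
    then have "X \<bullet> X = 0" using that(1) by (auto simp: b_def)
    with that(2) show False by simp
  qed
  have Btr: "B X Y = - (\<Sum>i\<in>Basis. D X (D Y i) \<bullet> i)" for X Y
    unfolding B_def sum_negf[symmetric]
    by (intro sum.cong refl) (metis skew inner_commute)
  \<comment> \<open>By \<open>flat\<close>, \<open>D\<close> of a bracket is a commutator, so
    invariance amounts to cyclicity of the trace of three operators.\<close>
  have Binv: "B (br X Y) Z = - B Y (br X Z)" for X Y Z
  proof -
    have lin3: "linear (\<lambda>z. D X (D Y z))" for X Y
      using linear_compose[OF linr linr] by (simp add: o_def)
    have "(\<Sum>i\<in>Basis. D X (D Y (D Z i)) \<bullet> i) = (\<Sum>i\<in>Basis. D Y (D Z (D X i)) \<bullet> i)"
      using trace_commute[OF linr[of X] lin3[of Y Z]] by simp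
    then show ?thesis
      unfolding Btr br_def flat
      by (simp add: lin_simps flat inner_diff_left sum_subtractf)
  qed

  obtain E where E: "E \<subseteq> b" "finite E" "span E = b"
      "\<forall>x\<in>E. \<forall>y\<in>E. B x y = (if x = y then 1 else 0)"
    using form_orthonormal_basis[OF B Bsym b] Bpos by blast
  define v where "v = (\<Sum>e\<in>E. D e e)"
  have vb: "v \<in> b"
    unfolding v_def using E(1) Db b by (intro subspace_sum) auto
  have Dv: "D X v = (\<Sum>e\<in>E. D e (D e X))" if X: "X \<in> b" for X
  proof -
    \<comment> \<open>The matrix of the bracket with \<open>X\<close> in the basis \<open>E\<close>;
      invariance of \<open>B\<close> makes it antisymmetric.\<close>
    define c where "c e e' = B (br X e) e'" for e e'
    have c: "c e' e = - c e e'" for e e'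
      unfolding c_def by (subst Binv) (rule arg_cong[OF Bsym])
    have exp: "br X e = (\<Sum>e'\<in>E. c e e' *\<^sub>R e')" if "e \<in> E" for e
      unfolding c_def using form_orthonormal_expansion[OF B E(2,4)] E(1,3) brb X that by blast
    \<comment> \<open>Flatness moves \<open>D X\<close> past \<open>D e\<close>, and zero torsion
      replaces \<open>D X e\<close> by \<open>D e X + br X e\<close>. The remainder is symmetric in
      \<open>e\<close> and \<open>br X e\<close>.\<close>
    have "D X (D e e) = D e (D e X) + (D e (br X e) + D (br X e) e)" for e
      using flat[of X e e] by (simp add: br_def lin_simps)
    then have "D X v = (\<Sum>e\<in>E. D e (D e X)) + (\<Sum>e\<in>E. D e (br X e) + D (br X e) e)"
      by (simp add: v_def linear_sum[OF linr] sum.distrib)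
    moreover have "(\<Sum>e\<in>E. D e (br X e) + D (br X e) e) = 0"
    proof -
      \<comment> \<open>An antisymmetric matrix contracted with an expression symmetric in
        \<open>e\<close> and \<open>e'\<close>: exchanging the indices gives
        \<open>S = - S\<close>.\<close>
      define S where "S = (\<Sum>e\<in>E. \<Sum>e'\<in>E. c e e' *\<^sub>R (D e e' + D e' e))"
      have "S = (\<Sum>e\<in>E. \<Sum>e'\<in>E. c e' e *\<^sub>R (D e' e + D e e'))"
        unfolding S_def by (rule sum.swap)
      also have "\<dots> = - S"
        unfolding S_def sum_negf[symmetric]
        by (intro sum.cong refl) (metis add.commute c scaleR_minus_left)
      finally have "S = 0" by (simp add: eq_neg_iff_add_eq_0 flip: scaleR_2)
      moreover have "(\<Sum>e\<in>E. D e (br X e) + D (br X e) e) = S"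
        unfolding S_def
        by (intro sum.cong refl)
          (simp add: exp linear_sum[OF linr] linear_sum[OF linl] lin_simps sum.distrib scaleR_add_right)
      ultimately show ?thesis by simp
    qed
    ultimately show ?thesis by simp
  qed
  \<comment> \<open>By skewness the first premise says that the squared norms of all
    \<open>D e X\<close> sum to zero.\<close>
  have casimir: "D e X = 0" if "(\<Sum>e\<in>E. D e (D e X)) \<bullet> X = 0" "e \<in> E" for X e
  proof -
    have "(\<Sum>e\<in>E. D e X \<bullet> D e X) = 0"
      using that(1) by (simp add: inner_sum_left skew[of _ "D _ X"] sum_negf)
    then show ?thesis
      using that(2) E(2) by (subst (asm) sum_nonneg_eq_0_iff) auto
  qed
  have spanE: "D Y X = 0" if "\<And>e. e \<in> E \<Longrightarrow> D e X = 0" "Y \<in> b" for X Y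
  proof -
    have "Y \<in> span E" using that(2) E(3) by simp
    then show ?thesis
      using linear_eq_on[OF linl linear_zero, of Y E X] that(1) by simp
  qed
  have "D v v \<bullet> v = 0" using skew[of v v v] by (simp add: inner_commute)
  then have "D Y v = 0" if "Y \<in> b" for Y
    using Dv[OF vb] casimir spanE that by metis
  then have "D e X = 0" if "X \<in> b" "e \<in> E" for X e
    using Dv that casimir by (metis inner_zero_left)
  then have Dbb: "D Y X = 0" if "X \<in> b" "Y \<in> b" for X Y
    using spanE that by blast

  have decomp: "\<exists>X'\<in>b. D X = D X'" for X
  proof -
    obtain P where "\<And>x. P x \<in> u" "\<And>x y. y \<in> u \<Longrightarrow> y \<bullet> (x - P x) = 0"
      using orthogonal_projection_exists[OF u] by blast
    then have "X - P X \<in> b" "D X = D (X - P X)"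
      by (auto simp: b_def u_def lin_simps)
    then show ?thesis by blast
  qed
  obtain X' Y' where "X' \<in> b" "D X = D X'" "Y' \<in> b" "D Y = D Y'"
    using decomp by metis
  then show ?thesis
    using flat[of X' Y' Z] Dbb by (simp add: lin_simps)
qed

section \<open>Invariant complex structures for commuting skew operators\<close>

text \<open>The value \<open>\<xi> = 0\<close> encodes a genuine complex structure on an even-dimensional \<open>S\<close>.\<close>

definition adapted_structure ::
    "('a::euclidean_space \<Rightarrow> 'a) set \<Rightarrow> 'a set \<Rightarrow> ('a \<Rightarrow> 'a) \<Rightarrow> 'a \<Rightarrow> bool" where
  "adapted_structure F S J \<xi> \<longleftrightarrow>
     linear J \<and> \<xi> \<in> S \<and> (\<forall>x\<in>S. J x \<in> S) \<and> (\<forall>x\<in>S. \<forall>y\<in>S. J x \<bullet> y = - (x \<bullet> J y)) \<and>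
     (\<forall>f\<in>F. \<forall>x\<in>S. J (f x) = f (J x)) \<and> (\<forall>f\<in>F. f \<xi> = 0) \<and>
     (\<forall>x\<in>S. J (J x) = - x + (\<xi> \<bullet> x) *\<^sub>R \<xi>) \<and> (\<xi> = 0 \<or> \<xi> \<bullet> \<xi> = 1)"

text \<open>Either admissible length of \<open>\<xi>\<close> gives \<open>J (J \<xi>) = 0\<close>,
  and skewness turns this into a vanishing norm of \<open>J \<xi>\<close>.\<close>

lemma adapted_structure_zero:
  assumes "adapted_structure F S J \<xi>"
  shows "J \<xi> = 0"
proof -
  have "J (J \<xi>) = 0" using assms by (auto simp: adapted_structure_def linear_0)
  moreover have "J \<xi> \<bullet> J \<xi> = - (\<xi> \<bullet> J (J \<xi>))"
    using assms by (auto simp: adapted_structure_def)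
  ultimately show ?thesis by simp
qed

text \<open>The gluing step for an induction on dimension. Every operator in \<open>F\<close> kills
  both \<open>\<xi>1\<close> and \<open>\<xi>2\<close>, so pairing these two vectors in a plane does
  not disturb commutation with \<open>F\<close>.\<close>

lemma adapted_structure_sum:
  fixes F :: "('a::euclidean_space \<Rightarrow> 'a) set"
  assumes lin: "\<And>f. f \<in> F \<Longrightarrow> linear f"
    and skew: "\<And>f x y. f \<in> F \<Longrightarrow> f x \<bullet> y = - (x \<bullet> f y)"
    and S: "subspace S" and T: "subspace T" and TS: "T \<subseteq> S"
    and Tinv: "\<And>f x. f \<in> F \<Longrightarrow> x \<in> T \<Longrightarrow> f x \<in> T"
    and U_def: "U = {y \<in> S. \<forall>x\<in>T. x \<bullet> y = 0}"
    and Uinv: "\<And>f x. f \<in> F \<Longrightarrow> x \<in> U \<Longrightarrow> f x \<in> U"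
    and 1: "adapted_structure F T J1 \<xi>1" and 2: "adapted_structure F U J2 \<xi>2"
  shows "\<exists>J \<xi>. adapted_structure F S J \<xi>"
proof -
  obtain P where P: "linear P" "\<And>x. P x \<in> T" "\<And>x y. y \<in> T \<Longrightarrow> y \<bullet> (x - P x) = 0"
    using orthogonal_projection_exists[OF T] by blast
  have U: "subspace U" using S by (auto simp: U_def subspace_def inner_add_right)
  have US: "U \<subseteq> S" by (auto simp: U_def)
  have orth: "x \<bullet> y = 0" "y \<bullet> x = 0" if "x \<in> T" "y \<in> U" for x y
    using that by (auto simp: U_def inner_commute)
  have lJ1: "linear J1" and xi1: "\<xi>1 \<in> T" and J1T: "\<And>x. x \<in> T \<Longrightarrow> J1 x \<in> T"
    and sk1: "\<And>x y. x \<in> T \<Longrightarrow> y \<in> T \<Longrightarrow> J1 x \<bullet> y = - (x \<bullet> J1 y)"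
    and co1: "\<And>f x. f \<in> F \<Longrightarrow> x \<in> T \<Longrightarrow> J1 (f x) = f (J1 x)" and f1: "\<And>f. f \<in> F \<Longrightarrow> f \<xi>1 = 0"
    and sq1: "\<And>x. x \<in> T \<Longrightarrow> J1 (J1 x) = - x + (\<xi>1 \<bullet> x) *\<^sub>R \<xi>1" and n1: "\<xi>1 = 0 \<or> \<xi>1 \<bullet> \<xi>1 = 1"
    using 1 by (auto simp: adapted_structure_def)
  have lJ2: "linear J2" and xi2: "\<xi>2 \<in> U" and J2U: "\<And>x. x \<in> U \<Longrightarrow> J2 x \<in> U"
    and sk2: "\<And>x y. x \<in> U \<Longrightarrow> y \<in> U \<Longrightarrow> J2 x \<bullet> y = - (x \<bullet> J2 y)"
    and co2: "\<And>f x. f \<in> F \<Longrightarrow> x \<in> U \<Longrightarrow> J2 (f x) = f (J2 x)" and f2: "\<And>f. f \<in> F \<Longrightarrow> f \<xi>2 = 0"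
    and sq2: "\<And>x. x \<in> U \<Longrightarrow> J2 (J2 x) = - x + (\<xi>2 \<bullet> x) *\<^sub>R \<xi>2" and n2: "\<xi>2 = 0 \<or> \<xi>2 \<bullet> \<xi>2 = 1"
    using 2 by (auto simp: adapted_structure_def)
  have J1xi: "J1 \<xi>1 = 0" and J2xi: "J2 \<xi>2 = 0"
    using adapted_structure_zero 1 2 by blast+
  \<comment> \<open>If both summands leave over a unit vector, the last two terms rotate one into the other.\<close>
  define J where "J x = J1 (P x) + J2 (x - P x) + (\<xi>1 \<bullet> x) *\<^sub>R \<xi>2 - (\<xi>2 \<bullet> x) *\<^sub>R \<xi>1" for x
  \<comment> \<open>Two nonzero leftover vectors are absorbed by the rotation, which leaves the
    value 0; otherwise at most one survives.\<close>
  define \<xi> where "\<xi> = (if \<xi>1 = 0 then \<xi>2 else if \<xi>2 = 0 then \<xi>1 else 0)"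
  have lJ: "linear J"
    by (rule linearI)
      (simp_all add: J_def linear_add[OF lJ1] linear_add[OF lJ2] linear_add[OF P(1)]
        linear_diff[OF lJ2] linear_cmul[OF lJ1] linear_cmul[OF lJ2] linear_cmul[OF P(1)]
        inner_add_right algebra_simps)
  have Padd: "P (a + c) = a" if "a \<in> T" "c \<in> U" for a c
  proof -
    have "a - P (a + c) \<in> T" using that P(2) T by (simp add: subspace_diff)
    then have "(a - P (a + c)) \<bullet> (a - P (a + c)) = 0"
      using P(3)[of "a - P (a + c)" "a + c"] orth(1)[of "a - P (a + c)" c] that
      by (simp add: inner_add_right inner_diff_right)
    then show ?thesis by simp
  qed
  have J_add: "J (a + c) = (J1 a - (\<xi>2 \<bullet> c) *\<^sub>R \<xi>1) + (J2 c + (\<xi>1 \<bullet> a) *\<^sub>R \<xi>2)"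
    if "a \<in> T" "c \<in> U" for a c
    using that Padd[OF that] orth xi1 xi2 by (simp add: J_def inner_add_right)
  have JT: "J1 a - t *\<^sub>R \<xi>1 \<in> T" if "a \<in> T" for a t
    using that T xi1 J1T by (simp add: subspace_diff subspace_scale)
  have JU: "J2 c + t *\<^sub>R \<xi>2 \<in> U" if "c \<in> U" for c t
    using that U xi2 J2U by (simp add: subspace_add subspace_scale)
  have inner_TU: "(p + q) \<bullet> (p' + q') = p \<bullet> p' + q \<bullet> q'"
    if "p \<in> T" "q \<in> U" "p' \<in> T" "q' \<in> U" for p q p' q'
    using that orth by (simp add: inner_add_left inner_add_right)
  have split: "\<exists>a\<in>T. \<exists>c\<in>U. x = a + c" if "x \<in> S" for x
  proof (intro bexI)
    show "x = P x + (x - P x)" by simp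
    show "x - P x \<in> U"
      using that P(3) subsetD[OF TS P(2)] S by (simp add: U_def subspace_diff)
  qed (rule P(2))
  have "J x \<in> S" if xS: "x \<in> S" for x
  proof -
    obtain a c where "a \<in> T" "c \<in> U" "x = a + c" using split[OF xS] by blast
    then show ?thesis
      using subspace_add[OF S subsetD[OF TS JT] subsetD[OF US JU]] by (simp add: J_add)
  qed
  moreover have "J x \<bullet> y = - (x \<bullet> J y)" if xS: "x \<in> S" and yS: "y \<in> S" for x y
  proof -
    obtain a c where x: "a \<in> T" "c \<in> U" "x = a + c" using split[OF xS] by blast
    obtain a' c' where y: "a' \<in> T" "c' \<in> U" "y = a' + c'" using split[OF yS] by blast
    have "J x \<bullet> y = (J1 a - (\<xi>2 \<bullet> c) *\<^sub>R \<xi>1) \<bullet> a' + (J2 c + (\<xi>1 \<bullet> a) *\<^sub>R \<xi>2) \<bullet> c'"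
      using x y JT JU by (simp add: J_add inner_TU)
    moreover have "x \<bullet> J y = a \<bullet> (J1 a' - (\<xi>2 \<bullet> c') *\<^sub>R \<xi>1) + c \<bullet> (J2 c' + (\<xi>1 \<bullet> a') *\<^sub>R \<xi>2)"
      using x y JT JU by (simp add: J_add inner_TU)
    ultimately show ?thesis
      using sk1[OF x(1) y(1)] sk2[OF x(2) y(2)]
      by (simp add: inner_diff_left inner_diff_right inner_add_left inner_add_right inner_commute)
  qed
  moreover have "J (f x) = f (J x)" if f: "f \<in> F" and "x \<in> S" for f x
  proof -
    obtain a c where x: "a \<in> T" "c \<in> U" "x = a + c" using split \<open>x \<in> S\<close> by blast
    have "\<xi>1 \<bullet> f a = 0" "\<xi>2 \<bullet> f c = 0"
      using skew[OF f, of \<xi>1 a] skew[OF f, of \<xi>2 c] f1[OF f] f2[OF f] by simp_all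
    then show ?thesis
      using x Tinv[OF f] Uinv[OF f] co1[OF f] co2[OF f] f1[OF f] f2[OF f] lin[OF f]
      by (simp add: J_add linear_add linear_diff linear_cmul)
  qed
  moreover have "J (J x) = - x + (\<xi> \<bullet> x) *\<^sub>R \<xi>" if xS: "x \<in> S" for x
  proof -
    obtain a c where x: "a \<in> T" "c \<in> U" "x = a + c" using split[OF xS] by blast
    have o: "\<xi>1 \<bullet> J1 a = 0" "\<xi>2 \<bullet> J2 c = 0"
      using sk1[OF xi1 x(1)] sk2[OF xi2 x(2)] J1xi J2xi by auto
    \<comment> \<open>The coefficient \<open>\<xi>2 \<bullet> \<xi>2\<close> is 1 or 0, so the
      \<open>\<xi>1\<close> terms cancel exactly when \<open>\<xi>2\<close> is nonzero; likewise
      with the roles exchanged.\<close>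
    have "J (J x) = (- a + (\<xi>1 \<bullet> a) *\<^sub>R \<xi>1 - ((\<xi>1 \<bullet> a) * (\<xi>2 \<bullet> \<xi>2)) *\<^sub>R \<xi>1)
        + (- c + (\<xi>2 \<bullet> c) *\<^sub>R \<xi>2 - ((\<xi>2 \<bullet> c) * (\<xi>1 \<bullet> \<xi>1)) *\<^sub>R \<xi>2)"
      using x by (simp add: J_add JT JU linear_diff[OF lJ1] linear_cmul[OF lJ1] J1xi J2xi sq1 sq2 o
          linear_add[OF lJ2] linear_cmul[OF lJ2] inner_add_right inner_diff_right)
    then show ?thesis
      using n1 n2 x orth[OF x(1) xi2] orth[OF xi1 x(2)] by (auto simp: \<xi>_def inner_add_right)
  qed
  ultimately have "adapted_structure F S J \<xi>"
    using lJ xi1 xi2 TS US n1 n2 f1 f2 S lin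
    by (auto simp: adapted_structure_def \<xi>_def subspace_0 linear_0)
  then show ?thesis by blast
qed

text \<open>Rayleigh's principle: a unit vector of \<open>S\<close> maximising the squared norm of
  \<open>f x\<close> is an eigenvector of the symmetric operator \<open>f\<close> squared, and
  \<open>m\<close> is the maximum.\<close>

lemma skew_square_eigenvector:
  fixes f :: "'a::euclidean_space \<Rightarrow> 'a"
  assumes f: "linear f" and skew: "\<And>x y. f x \<bullet> y = - (x \<bullet> f y)"
    and S: "subspace S" "\<And>x. x \<in> S \<Longrightarrow> f x \<in> S" and ne: "z \<in> S" "f z \<noteq> 0"
  shows "\<exists>m>0. \<exists>x\<in>S. x \<noteq> 0 \<and> f (f x) = - m *\<^sub>R x"
proof -
  have "z \<noteq> 0" using ne linear_0[OF f] by auto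
  have unit: "(1 / norm y) *\<^sub>R y \<in> S \<inter> sphere 0 1" if "y \<in> S" "y \<noteq> 0" for y
    using that S(1) by (simp add: subspace_scale)
  have "compact (S \<inter> sphere 0 1)"
    using closed_subspace[OF S(1)] by (simp add: closed_Int_compact)
  moreover have "S \<inter> sphere 0 1 \<noteq> {}" using unit[OF ne(1) \<open>z \<noteq> 0\<close>] by blast
  moreover have "continuous_on (S \<inter> sphere 0 1) (\<lambda>x. f x \<bullet> f x)"
    using f by (intro continuous_intros linear_continuous_on_compose[OF continuous_on_id]) 
  ultimately obtain x where x: "x \<in> S \<inter> sphere 0 1"
      and max: "\<And>y. y \<in> S \<inter> sphere 0 1 \<Longrightarrow> f y \<bullet> f y \<le> f x \<bullet> f x"
    using continuous_attains_sup[of "S \<inter> sphere 0 1" "\<lambda>x. f x \<bullet> f x"] by blast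
  define m where "m = f x \<bullet> f x"
  have xx: "x \<bullet> x = 1" and xS: "x \<in> S" using x by (auto simp: norm_eq_1)
  have le: "f y \<bullet> f y \<le> m * (y \<bullet> y)" if "y \<in> S" for y
  proof (cases "y = 0")
    case False
    have "f ((1 / norm y) *\<^sub>R y) \<bullet> f ((1 / norm y) *\<^sub>R y) \<le> m"
      using max[OF unit[OF that False]] by (simp add: m_def)
    then show ?thesis
      using False by (simp add: linear_cmul[OF f] dot_square_norm field_simps power2_eq_square)
  qed (simp add: linear_0[OF f])
  \<comment> \<open>The form \<open>m * (y \<bullet> y) - f y \<bullet> f y\<close> is nonnegative on \<open>S\<close> and vanishes at \<open>x\<close>,
    so \<open>x\<close> lies in its radical.\<close>
  define w where "w = f (f x) + m *\<^sub>R x"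
  have wS: "w \<in> S" using xS S by (simp add: w_def subspace_add subspace_scale)
  have "f x \<bullet> f w = - (f (f x) \<bullet> w)" using skew[of "f x" w] by simp
  then have q: "m * (x \<bullet> w) - f x \<bullet> f w = w \<bullet> w"
    by (simp add: w_def inner_add_left)
  define c where "c = m * (w \<bullet> w) - f w \<bullet> f w"
  have c: "c \<ge> 0" using le[OF wS] by (simp add: c_def)
  \<comment> \<open>Perturb \<open>x\<close> along the defect \<open>w\<close> of the eigenvector
    equation. The constant term vanishes at the maximiser, and by \<open>q\<close> the linear
    coefficient is \<open>2 * (w \<bullet> w)\<close>.\<close>
  have quad: "0 \<le> 2 * t * (w \<bullet> w) + t\<^sup>2 * c" for t
  proof -
    have "x + t *\<^sub>R w \<in> S" using xS wS S(1) by (simp add: subspace_add subspace_scale)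
    from le[OF this] have "0 \<le> m * ((x + t *\<^sub>R w) \<bullet> (x + t *\<^sub>R w)) - f (x + t *\<^sub>R w) \<bullet> f (x + t *\<^sub>R w)"
      by simp
    also have "\<dots> = 2 * t * (m * (x \<bullet> w) - f x \<bullet> f w) + t\<^sup>2 * c"
      by (simp add: linear_add[OF f] linear_cmul[OF f] inner_add_left inner_add_right xx c_def
          inner_commute[of w x] inner_commute[of "f w" "f x"] m_def[symmetric] algebra_simps power2_eq_square)
    finally show ?thesis by (simp add: q)
  qed
  have "w \<bullet> w = 0"
  proof (rule ccontr)
    assume "w \<bullet> w \<noteq> 0"
    then have pos: "w \<bullet> w > 0" by simp
    \<comment> \<open>Since \<open>c\<close> may be 0, the denominator is \<open>c + 1\<close>; the
      quadratic then takes the negative value \<open>- (t\<^sup>2 * (c + 2))\<close>.\<close>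
    define t where "t = - (w \<bullet> w) / (c + 1)"
    have ww: "w \<bullet> w = - t * (c + 1)" and "t \<noteq> 0"
      using c pos by (simp_all add: t_def)
    have "0 \<le> 2 * t * (w \<bullet> w) + t\<^sup>2 * c" by (rule quad)
    also have "\<dots> = - (t\<^sup>2 * (c + 2))"
      by (simp add: ww algebra_simps power2_eq_square)
    also have "\<dots> < 0"
      using c \<open>t \<noteq> 0\<close> by simp
    finally show False by simp
  qed
  then have "f (f x) = - m *\<^sub>R x" by (simp add: w_def add_eq_0_iff)
  moreover have "m > 0"
  proof -
    have "0 < f z \<bullet> f z" using ne by simp
    also have "\<dots> \<le> m * (z \<bullet> z)" by (rule le[OF ne(1)])
    finally show ?thesis by (metis inner_ge_zero zero_less_mult_pos2 zero_less_mult_iff not_less)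
  qed
  moreover have "x \<noteq> 0" using xx by auto
  ultimately show ?thesis using xS by blast
qed

text \<open>Induction on \<open>dim S\<close>. Commutativity makes every eigenspace of the square of
  some \<open>f\<close> in \<open>F\<close> invariant under \<open>F\<close>, so \<open>S\<close>
  splits until such a square is a negative scalar on \<open>S\<close> or \<open>F\<close> acts by
  zero.\<close>

lemma commuting_skew_adapted_structure:
  fixes F :: "('a::euclidean_space \<Rightarrow> 'a) set"
  assumes lin: "\<And>f. f \<in> F \<Longrightarrow> linear f"
    and skew: "\<And>f x y. f \<in> F \<Longrightarrow> f x \<bullet> y = - (x \<bullet> f y)"
    and comm: "\<And>f g x. f \<in> F \<Longrightarrow> g \<in> F \<Longrightarrow> f (g x) = g (f x)"
    and "subspace S" and "\<And>f x. f \<in> F \<Longrightarrow> x \<in> S \<Longrightarrow> f x \<in> S"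
  shows "\<exists>J \<xi>. adapted_structure F S J \<xi>"
  using assms(4,5)
proof (induction "dim S" arbitrary: S rule: less_induct)
  case less
  note S = less.prems(1) and inv = less.prems(2)
  have less_dim: "dim T < dim S" if "subspace T" "T \<subseteq> S" "T \<noteq> S" for T
    using that S by (metis dim_subset le_neq_implies_less subspace_dim_equal)
  \<comment> \<open>The vector \<open>x\<close> certifies that \<open>T\<close> is nonzero, so
    \<open>T\<close> and its complement in \<open>S\<close> both have smaller dimension.\<close>
  have split: ?case if T: "subspace T" "T \<subseteq> S" "T \<noteq> S" "x \<in> T" "x \<noteq> 0"
    and Tinv: "\<And>f x. f \<in> F \<Longrightarrow> x \<in> T \<Longrightarrow> f x \<in> T" for T x
  proof -
    define U where "U = {y \<in> S. \<forall>x\<in>T. x \<bullet> y = 0}"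
    have U: "subspace U" using S by (auto simp: U_def subspace_def inner_add_right)
    have "x \<notin> U" using T(4,5) by (auto simp: U_def intro!: bexI[of _ x])
    then have UneS: "U \<noteq> S" using T(2,4) by blast
    have US: "U \<subseteq> S" by (auto simp: U_def)
    have Uinv: "f y \<in> U" if "f \<in> F" "y \<in> U" for f y
      unfolding U_def
    proof (intro CollectI conjI ballI)
      show "f y \<in> S" using that inv by (simp add: U_def)
      fix x assume "x \<in> T"
      then show "x \<bullet> f y = 0" using skew[OF that(1), of x y] Tinv that by (simp add: U_def)
    qed
    obtain J1 \<xi>1 where 1: "adapted_structure F T J1 \<xi>1"
      using less.hyps[OF less_dim[OF T(1-3)] T(1)] Tinv by blast
    obtain J2 \<xi>2 where 2: "adapted_structure F U J2 \<xi>2"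
      using less.hyps[OF less_dim[OF U US UneS] U] Uinv by blast
    show ?thesis
      by (rule adapted_structure_sum[OF _ _ S T(1,2) _ U_def _ 1 2]) (fact lin skew Tinv Uinv)+
  qed
  show ?case
  proof (cases "\<exists>f\<in>F. \<exists>z\<in>S. f z \<noteq> 0")
    case True
    then obtain f z where f: "f \<in> F" and z: "z \<in> S" "f z \<noteq> 0" by blast
    obtain m x where m: "m > 0" and x: "x \<in> S" "x \<noteq> 0" "f (f x) = - m *\<^sub>R x"
      using skew_square_eigenvector[OF lin[OF f] skew[OF f] S inv[OF f] z] by blast
    define T where "T = {y \<in> S. f (f y) = - m *\<^sub>R y}"
    show ?thesis
    proof (cases "T = S")
      case False
      show ?thesis
      proof (rule split)
        show "subspace T"
          using S by (auto simp: T_def subspace_def linear_add[OF lin[OF f]] linear_cmul[OF lin[OF f]]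
              linear_0[OF lin[OF f]] algebra_simps)
        show "g y \<in> T" if "g \<in> F" "y \<in> T" for g y
          using that inv f by (simp add: T_def comm[OF f that(1)] linear_neg[OF lin[OF that(1)]] linear_cmul[OF lin[OF that(1)]])
        show "x \<in> T" using x by (simp add: T_def)
      qed (use x False in \<open>auto simp: T_def\<close>)
    next
      case True
      \<comment> \<open>Now \<open>f\<close> squares to \<open>- m\<close> on all of
        \<open>S\<close>, so dividing by \<open>sqrt m\<close> gives a complex structure, which
        commutes with \<open>F\<close> because \<open>f\<close> does.\<close>
      define J where "J y = (1 / sqrt m) *\<^sub>R f y" for y
      have "f (f y) = - m *\<^sub>R y" if "y \<in> S" for y using that True by (auto simp: T_def)
      then have JJ: "J (J y) = - y" if "y \<in> S" for y
        using that m by (simp add: J_def linear_cmul[OF lin[OF f]])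
      have "adapted_structure F S J 0"
        unfolding adapted_structure_def
      proof (intro conjI ballI disjI1 refl)
        show "linear J"
          unfolding J_def by (rule linear_compose_scale_right[OF lin[OF f]])
        show "0 \<in> S" using S by (rule subspace_0)
        show "J y \<in> S" if "y \<in> S" for y
          using inv[OF f that] S by (simp add: J_def subspace_scale)
        show "J y \<bullet> y' = - (y \<bullet> J y')" for y y'
          by (simp add: J_def skew[OF f])
        show "J (g y) = g (J y)" if "g \<in> F" for g y
          by (simp add: J_def comm[OF f that] linear_cmul[OF lin[OF that]])
        show "g 0 = 0" if "g \<in> F" for g by (rule linear_0[OF lin[OF that]])
        show "J (J y) = - y + (0 \<bullet> y) *\<^sub>R 0" if "y \<in> S" for y using JJ[OF that] by simp
      qed
      then show ?thesis by blast
    qed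
  next
    case False
    show ?thesis
    proof (cases "S = {0}")
      case True
      then have "adapted_structure F S (\<lambda>x. 0) 0"
        using lin by (auto simp: adapted_structure_def linear_0 linear_zero)
      then show ?thesis by blast
    next
      case S0: False
      then obtain x where x: "x \<in> S" "x \<noteq> 0" using S subspace_0 by blast
      \<comment> \<open>All of \<open>F\<close> vanishes on \<open>S\<close>, so every line is
        invariant and can be split off. A single remaining line carries \<open>J = 0\<close> and
        \<open>\<xi> = e\<close>.\<close>
      define e where "e = (1 / norm x) *\<^sub>R x"
      have e: "e \<in> S" "e \<noteq> 0" "e \<bullet> e = 1"
        using x S by (auto simp: e_def subspace_scale dot_square_norm power2_eq_square)
      have spanS: "span {e} \<subseteq> S" using e(1) S by (simp add: span_minimal)
      show ?thesis
      proof (cases "span {e} = S")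
        case True
        have "(e \<bullet> y) *\<^sub>R e = y" if "y \<in> S" for y
          using that e(3) by (auto simp: True[symmetric] span_singleton)
        then have "adapted_structure F S (\<lambda>x. 0) e"
          using False e S lin
          by (auto simp: adapted_structure_def subspace_0 linear_0 linear_zero)
        then show ?thesis by blast
      next
        case ne: False
        show ?thesis
        proof (rule split[OF subspace_span spanS ne])
          show "e \<in> span {e}" by (simp add: span_base)
          show "f y \<in> span {e}" if "f \<in> F" "y \<in> span {e}" for f y
            using that False spanS by (metis span_zero subsetD)
        qed (rule e(2))
      qed
    qed
  qed
qed

text \<open>Split off the plane spanned by \<open>x\<close> and \<open>J x\<close>; by skewness
  these are orthogonal and the complement is again \<open>J\<close>-invariant. The result serves to
  exclude \<open>\<xi> = 0\<close> in odd dimension.\<close>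

lemma even_dim_skew_complex:
  fixes S :: "'a::euclidean_space set"
  assumes J: "linear J" and "subspace S" "\<And>x. x \<in> S \<Longrightarrow> J x \<in> S"
    and "\<And>x y. x \<in> S \<Longrightarrow> y \<in> S \<Longrightarrow> J x \<bullet> y = - (x \<bullet> J y)" and "\<And>x. x \<in> S \<Longrightarrow> J (J x) = - x"
  shows "even (dim S)"
  using assms(2-)
proof (induction "dim S" arbitrary: S rule: less_induct)
  case less
  show ?case
  proof (cases "S = {0}")
    case False
    then obtain x where x: "x \<in> S" "x \<noteq> 0" using less.prems(1) subspace_0 by blast
    have Jx: "J x \<in> S" using less.prems(2) x by blast
    have orth: "x \<bullet> J x = 0"
      using less.prems(3)[OF x(1) x(1)] by (simp add: inner_commute)
    have Jne: "J x \<noteq> 0" using less.prems(4)[OF x(1)] x(2) linear_0[OF J] by force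
    have ne: "x \<noteq> J x" using orth x(2) by force
    define T where "T = span {x, J x}"
    have "independent {x, J x}"
      using orth x(2) Jne
      by (intro pairwise_orthogonal_independent)
        (auto simp: pairwise_def orthogonal_def inner_commute)
    then have "dim T = 2"
      using ne by (simp add: T_def dim_eq_card_independent)
    have TS: "T \<subseteq> S" using x(1) Jx less.prems(1) by (simp add: T_def span_minimal)
    have T: "subspace T" by (simp add: T_def)
    have JT: "J t \<in> T" if "t \<in> T" for t
    proof -
      have "J ` T = span (J ` {x, J x})" unfolding T_def by (rule linear_span_image[OF J, symmetric])
      also have "\<dots> \<subseteq> T"
        unfolding T_def using less.prems(4)[OF x(1)]
        by (intro span_minimal) (auto simp: span_base span_neg)
      finally show ?thesis using that by blast
    qed
    define U where "U = {y \<in> S. \<forall>t\<in>T. orthogonal t y}"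
    have dim: "dim U + dim T = dim S"
      unfolding U_def by (rule dim_subspace_orthogonal_to_vectors[OF T less.prems(1) TS])
    have "even (dim U)"
    proof (rule less.hyps)
      show "dim U < dim S" using dim \<open>dim T = 2\<close> by simp
      show "subspace U"
        using less.prems(1) by (auto simp: U_def subspace_def orthogonal_def inner_add_right)
      show "J y \<in> U" if "y \<in> U" for y
        unfolding U_def
      proof (intro CollectI conjI ballI)
        show "J y \<in> S" using that less.prems(2) by (simp add: U_def)
        fix t assume "t \<in> T"
        then show "orthogonal t (J y)"
          using less.prems(3)[of t y] TS that JT[of t] by (auto simp: U_def orthogonal_def)
      qed
    qed (use less.prems in \<open>auto simp: U_def\<close>)
    then show ?thesis using dim \<open>dim T = 2\<close> by (metis even_add even_numeral)
  qed simp
qed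

section \<open>From parallel tensors to the coKaehler structure\<close>

text \<open>\<open>J\<close> and \<open>\<xi>\<close> are parallel for a torsion-free metric
  connection \<open>N\<close>. Replacing each bracket by \<open>N X Y - N Y X\<close> makes the
  terms of every differential identity vanish or cancel in pairs.\<close>

lemma cokaehler_of_commuting_connection:
  fixes br :: "'a::euclidean_space \<Rightarrow> 'a \<Rightarrow> 'a"
  assumes br: "lie_bracket br" and ipr: "inner_product ip" and dim: "odd DIM('a)"
    and J: "linear J" and xi1: "ip \<xi> \<xi> = 1"
    and Jsk: "\<And>X Y. ip (J X) Y = - ip X (J Y)"
    and J2: "\<And>X. J (J X) = - X + ip \<xi> X *\<^sub>R \<xi>"
    and torsion: "\<And>X Y. br X Y = N X Y - N Y X"
    and Nsk: "\<And>X Y Z. ip (N X Y) Z = - ip Y (N X Z)"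
    and NJ: "\<And>X Y. J (N X Y) = N X (J Y)" and Nxi: "\<And>X. N X \<xi> = 0"
  shows "cokaehler_structure br J \<xi> (ip \<xi>) ip"
proof -
  have ip: "bilinear ip" and sym: "\<And>X Y. ip X Y = ip Y X"
    using ipr by (auto simp: inner_product_def)
  note ip_simps = bilinear_ladd[OF ip] bilinear_radd[OF ip] bilinear_lmul[OF ip] bilinear_rmul[OF ip]
    bilinear_lzero[OF ip] bilinear_rzero[OF ip] bilinear_lsub[OF ip] bilinear_rsub[OF ip]
    bilinear_lneg[OF ip] bilinear_rneg[OF ip]
  have "\<xi> \<noteq> 0" using xi1 ip_simps(5) by force
  moreover have "\<exists>n. DIM('a) = 2 * n + 1" using dim by (rule oddE) blast
  moreover have "linear (ip \<xi>)" using ip by (simp add: bilinear_def)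
  moreover have "ip (J X) (J Y) = ip X Y - ip \<xi> X * ip \<xi> Y" for X Y
    by (simp add: Jsk[of X] J2 ip_simps sym[of X \<xi>])
  moreover have "ce_d1 br (ip \<xi>) X Y = 0" for X Y
    using Nsk[of X \<xi> Y] Nsk[of Y \<xi> X] by (simp add: ce_d1_def torsion ip_simps Nxi)
  moreover have "nijenhuis br J X Y = 0" for X Y
    by (simp add: nijenhuis_def torsion linear_diff[OF J] NJ)
  moreover have "ce_d2 br (fundamental_form J ip) X Y Z = 0" for X Y Z
  proof -
    \<comment> \<open>\<open>J\<close> and \<open>N X\<close> are commuting skew operators, so their
      composite is symmetric; the six terms of the differential then cancel.\<close>
    have "ip (J (N X Y)) Z = ip (J (N X Z)) Y" for X Y Z
      by (metis Jsk NJ Nsk sym minus_minus)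
    then show ?thesis
      by (simp add: ce_d2_def fundamental_form_def torsion linear_diff[OF J] ip_simps)
  qed
  ultimately show ?thesis
    unfolding cokaehler_structure_def using br ipr J J2 xi1 by blast
qed

lemma levi_civita_properties:
  fixes br :: "'a::euclidean_space \<Rightarrow> 'a \<Rightarrow> 'a"
  assumes m: "metric_lie_algebra br ip"
  shows "bilinear (levi_civita br ip)"
    and "ip (levi_civita br ip X Y) Z = - ip Y (levi_civita br ip X Z)"
    and "br X Y = levi_civita br ip X Y - levi_civita br ip Y X"
proof -
  let ?N = "levi_civita br ip"
  have br: "bilinear br" and ip: "bilinear ip" and pos: "\<And>X. X \<noteq> 0 \<Longrightarrow> ip X X > 0"
    and sym: "\<And>X Y. ip X Y = ip Y X" and br0: "\<And>X. br X X = 0"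
    using m by (auto simp: metric_lie_algebra_def lie_bracket_def inner_product_def)
  note ip_simps = bilinear_ladd[OF ip] bilinear_radd[OF ip] bilinear_lmul[OF ip] bilinear_rmul[OF ip]
    bilinear_lsub[OF ip] bilinear_rsub[OF ip] bilinear_lneg[OF ip] bilinear_rneg[OF ip]
    bilinear_ladd[OF br] bilinear_radd[OF br] bilinear_lmul[OF br] bilinear_rmul[OF br]
  have anti: "br Y X = - br X Y" for X Y
  proof -
    have "br X X + (br Y X + (br X Y + br Y Y)) = 0"
      using br0[of "X + Y"] by (simp only: bilinear_ladd[OF br] bilinear_radd[OF br] add.assoc)
    then show ?thesis by (simp add: br0 eq_neg_iff_add_eq_0)
  qed
  note koszul = levi_civita_koszul[OF m]
  \<comment> \<open>Nondegeneracy of \<open>ip\<close>. The factor 2 is kept so that both sides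
    match the left side of \<open>koszul\<close>.\<close>
  have eqI: "V = W" if "\<And>Z. 2 * ip V Z = 2 * ip W Z" for V W
    using pos[of "V - W"] that[of "V - W"] by (auto simp: ip_simps)
  have "?N (X + X') Y = ?N X Y + ?N X' Y" for X X' Y
    by (rule eqI) (simp add: ip_simps koszul distrib_left)
  moreover have "?N X (Y + Y') = ?N X Y + ?N X Y'" for X Y Y'
    by (rule eqI) (simp add: ip_simps koszul distrib_left)
  moreover have "?N (c *\<^sub>R X) Y = c *\<^sub>R ?N X Y" for c X Y
  proof (rule eqI)
    fix Z show "2 * ip (?N (c *\<^sub>R X) Y) Z = 2 * ip (c *\<^sub>R ?N X Y) Z"
      using koszul[of X Y Z] by (simp add: ip_simps koszul mult.left_commute[of 2] right_diff_distrib distrib_left)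
  qed
  moreover have "?N X (c *\<^sub>R Y) = c *\<^sub>R ?N X Y" for c X Y
  proof (rule eqI)
    fix Z show "2 * ip (?N X (c *\<^sub>R Y)) Z = 2 * ip (c *\<^sub>R ?N X Y) Z"
      using koszul[of X Y Z] by (simp add: ip_simps koszul mult.left_commute[of 2] right_diff_distrib distrib_left)
  qed
  ultimately show "bilinear ?N"
    unfolding bilinear_def by (auto intro!: linearI)
  show "ip (?N X Y) Z = - ip Y (?N X Z)"
    using koszul[of X Y Z] koszul[of X Z Y] sym[of Y "?N X Z"]
    by (simp add: anti[of X Z] anti[of X Y] anti[of Y Z] ip_simps)
  show "br X Y = ?N X Y - ?N Y X"
  proof (rule eqI)
    fix Z show "2 * ip (br X Y) Z = 2 * ip (?N X Y - ?N Y X) Z"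
      using koszul[of X Y Z] koszul[of Y X Z]
      by (simp add: anti[of X Y] anti[of X Z] anti[of Y Z] ip_simps)
  qed
qed

theorem theorem3p4:
  fixes br :: "'a::euclidean_space \<Rightarrow> 'a \<Rightarrow> 'a"
    and ip :: "'a \<Rightarrow> 'a \<Rightarrow> real"
  assumes "flat_lie_algebra br ip"
    and "odd (DIM('a))"
  shows "\<exists>J \<xi> \<alpha> ip'. cokaehler_structure br J \<xi> \<alpha> ip'"
proof -
  define N where "N = levi_civita br ip"
  have m: "metric_lie_algebra br ip" and curv: "\<And>X Y Z. curvature br ip X Y Z = 0"
    using assms(1) by (auto simp: flat_lie_algebra_def)
  then have br: "lie_bracket br" and ipr: "inner_product ip" by (auto simp: metric_lie_algebra_def)
  have N: "bilinear N" and Nsk: "\<And>X Y Z. ip (N X Y) Z = - ip Y (N X Z)"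
    and torsion: "\<And>X Y. br X Y = N X Y - N Y X"
    unfolding N_def using levi_civita_properties[OF m] by auto
  have flat: "N (N X Y - N Y X) Z = N X (N Y Z) - N Y (N X Z)" for X Y Z
    using curv[of X Y Z] by (simp add: curvature_def N_def[symmetric] torsion)
  obtain f g :: "'a \<Rightarrow> 'a" where f: "linear f" and g: "linear g" and fg: "\<And>x. f (g x) = x" and gf: "\<And>x. g (f x) = x"
    and iso: "\<And>x y. ip (f x) (f y) = x \<bullet> y"
    using inner_product_isometry[OF ipr] by metis
  have ip_eq: "ip X Y = g X \<bullet> g Y" for X Y using iso[of "g X" "g Y"] by (simp add: fg)
  \<comment> \<open>The Levi-Civita connection carried over to \<open>\<bullet>\<close> along the
    isometry \<open>f\<close> with inverse \<open>g\<close>.\<close>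
  define D where "D X Y = g (N (f X) (f Y))" for X Y
  have D: "bilinear D"
    unfolding bilinear_def D_def
    by (auto intro!: linearI simp: linear_add[OF f] linear_add[OF g] linear_cmul[OF f] linear_cmul[OF g]
        bilinear_ladd[OF N] bilinear_radd[OF N] bilinear_lmul[OF N] bilinear_rmul[OF N])
  have Dsk: "D X Y \<bullet> Z = - (Y \<bullet> D X Z)" for X Y Z
    using Nsk[of "f X" "f Y" "f Z"] by (simp add: D_def ip_eq gf)
  have Dflat: "D (D X Y - D Y X) Z = D X (D Y Z) - D Y (D X Z)" for X Y Z
    by (simp add: D_def linear_diff[OF f] fg flat linear_diff[OF g])
  have "\<exists>J \<xi>. adapted_structure (range D) UNIV J \<xi>"
    using D Dsk flat_connection_commutes[OF D Dsk Dflat]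
    by (intro commuting_skew_adapted_structure) (auto simp: bilinear_def)
  then obtain J \<xi> where "adapted_structure (range D) UNIV J \<xi>" by blast
  then have J: "linear J" and Jsk: "\<And>x y. J x \<bullet> y = - (x \<bullet> J y)"
    and JD: "\<And>X x. J (D X x) = D X (J x)" and Dxi: "\<And>X. D X \<xi> = 0"
    and J2: "\<And>x. J (J x) = - x + (\<xi> \<bullet> x) *\<^sub>R \<xi>" and xi: "\<xi> = 0 \<or> \<xi> \<bullet> \<xi> = 1"
    by (auto simp: adapted_structure_def)
  \<comment> \<open>Otherwise \<open>J\<close> would be a skew complex structure on the whole space,
    whose dimension is odd.\<close>
  have "\<xi> \<noteq> 0"
  proof
    assume "\<xi> = 0"
    then have "even (dim (UNIV :: 'a set))"
      using J2 Jsk by (intro even_dim_skew_complex[OF J]) auto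
    with assms(2) show False by simp
  qed
  with xi have xi1: "\<xi> \<bullet> \<xi> = 1" by blast
  \<comment> \<open>\<open>J\<close> and \<open>\<xi>\<close> are carried back along
    \<open>f\<close>; the given \<open>ip\<close> itself serves as the inner product of the
    structure.\<close>
  have "cokaehler_structure br (\<lambda>X. f (J (g X))) (f \<xi>) (ip (f \<xi>)) ip"
  proof (rule cokaehler_of_commuting_connection[where N = N])
    show "linear (\<lambda>X. f (J (g X)))"
      using linear_compose[OF linear_compose[OF g J] f] by (simp add: o_def)
    show "ip (f \<xi>) (f \<xi>) = 1" by (simp add: iso xi1)
    show "ip (f (J (g X))) Y = - ip X (f (J (g Y)))" for X Y by (simp add: ip_eq gf Jsk)
    show "f (J (g (f (J (g X))))) = - X + ip (f \<xi>) X *\<^sub>R f \<xi>" for X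
      by (simp add: gf J2 linear_add[OF f] linear_neg[OF f] linear_diff[OF f] linear_cmul[OF f] fg ip_eq)
    show "f (J (g (N X Y))) = N X (f (J (g Y)))" for X Y
      using arg_cong[OF JD[of "g X" "g Y"], of f] by (simp add: D_def fg)
    show "N X (f \<xi>) = 0" for X
      using arg_cong[OF Dxi[of "g X"], of f] by (simp add: D_def fg linear_0[OF f])
  qed (fact br ipr assms(2) torsion Nsk)+
  then show ?thesis by blast
qed

end
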